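(* If a contractive weighted shift $S_{\boldsymbol{\lambda}}$ on the directed tree $\mathcal{T}^0$ is of class $C_{1\cdot}$, then it has no cyclic vectors.
   Context: $\mathcal{T}^0=(V^0,E^0)$ is the directed tree with vertex set $V^0=\mathbb{Z}\cup\{k'\colon k\in\mathbb{N}\}$ (the primed symbols $1',2',\dots$ are distinct additional vertices) and edge set $E^0=\{(k,k+1)\colon k\in\mathbb{Z}\}\cup\{(0,1')\}\cup\{(k',(k+1)')\colon k\in\mathbb{N}\}$. For $u\in V^0$, $\mathrm{Chi}(u)=\{v\in V^0\colon(u,v)\in E^0\}$. Given a bounded family of positive weights $\boldsymbol{\lambda}=\{\lambda_v\colon v\in V^0\}\subseteq(0,\infty)$, the weighted shift $S_{\boldsymbol{\lambda}}$ is the bounded operator on the complex Hilbert space $\ell^2(V^0)$ (with orthonormal basis $\{e_u\}_{u\in V^0}$) given by $S_{\boldsymbol{\lambda}}e_u=\sum_{v\in\mathrm{Chi}(u)}\lambda_ve_v$ (all weights are assumed positive). It is contractive if $\|S_{\boldsymbol{\lambda}}\|\le1$. A contraction $T\in\mathcal{B}(\mathcal{H})$ is of class $C_{1\cdot}$ if $h=0$ is the only vector $h\in\mathcal{H}$ with $\lim_n\|T^nh\|=0$. A vector $h$ is cyclic for $T\in\mathcal{B}(\mathcal{H})$ if the closed linear span of $\{T^nh\colon n\ge0\}$ is $\mathcal{H}$. *)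

theory Defs
  imports "HOL-Analysis.Analysis"
begin

typedef 'a ell2 = "{f :: 'a \<Rightarrow> complex. (\<lambda>v. (cmod (f v))\<^sup>2) summable_on UNIV}"
  morphisms coord Abs_ell2
  by (rule exI[of _ "\<lambda>_. 0"]) simp

setup_lifting type_definition_ell2

lemma summable_on_inner:
  fixes f g :: "'a \<Rightarrow> complex"
  assumes "(\<lambda>v. (cmod (f v))\<^sup>2) summable_on UNIV" "(\<lambda>v. (cmod (g v))\<^sup>2) summable_on UNIV"
  shows "(\<lambda>v. f v \<bullet> g v) summable_on UNIV"
proof (rule abs_summable_summable, rule summable_on_comparison_test)
  show "(\<lambda>v. (cmod (f v))\<^sup>2 + (cmod (g v))\<^sup>2) summable_on UNIV"
    using assms by (rule summable_on_add)
  fix v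
  have "norm (f v \<bullet> g v) \<le> cmod (f v) * cmod (g v)"
    by (simp add: Cauchy_Schwarz_ineq2)
  also have "\<dots> \<le> (cmod (f v))\<^sup>2 + (cmod (g v))\<^sup>2"
    using sum_squares_bound[of "cmod (f v)" "cmod (g v)"]
      mult_nonneg_nonneg[OF norm_ge_zero norm_ge_zero, of "f v" "g v"] by linarith
  finally show "norm (f v \<bullet> g v) \<le> (cmod (f v))\<^sup>2 + (cmod (g v))\<^sup>2" .
qed auto

instantiation ell2 :: (type) real_vector
begin

lift_definition zero_ell2 :: "'a ell2" is "\<lambda>_. 0" by simp

lift_definition plus_ell2 :: "'a ell2 \<Rightarrow> 'a ell2 \<Rightarrow> 'a ell2" is "\<lambda>f g v. f v + g v"
proof -
  fix f g :: "'a \<Rightarrow> complex"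
  assume f: "(\<lambda>v. (cmod (f v))\<^sup>2) summable_on UNIV" and g: "(\<lambda>v. (cmod (g v))\<^sup>2) summable_on UNIV"
  have "(\<lambda>v. (cmod (f v))\<^sup>2 + (cmod (g v))\<^sup>2 + 2 * (f v \<bullet> g v)) summable_on UNIV"
    by (intro summable_on_add summable_on_cmult_right f g summable_on_inner)
  then show "(\<lambda>v. (cmod (f v + g v))\<^sup>2) summable_on UNIV"
    by (simp add: power2_norm_eq_inner inner_add_left inner_add_right inner_commute algebra_simps)
qed

lift_definition uminus_ell2 :: "'a ell2 \<Rightarrow> 'a ell2" is "\<lambda>f v. - f v" by simp

definition minus_ell2 :: "'a ell2 \<Rightarrow> 'a ell2 \<Rightarrow> 'a ell2" where
  "minus_ell2 x y = x + - y"

lift_definition scaleR_ell2 :: "real \<Rightarrow> 'a ell2 \<Rightarrow> 'a ell2" is "\<lambda>r f v. r *\<^sub>R f v"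
  by (simp add: power_mult_distrib summable_on_cmult_right)

instance
proof
  fix x y z :: "'a ell2" and r s :: real
  show "x + y + z = x + (y + z)" by transfer (simp add: add.assoc)
  show "x + y = y + x" by transfer (simp add: add.commute)
  show "0 + x = x" by transfer simp
  show "- x + x = 0" by transfer simp
  show "x - y = x + - y" by (simp add: minus_ell2_def)
  show "r *\<^sub>R (x + y) = r *\<^sub>R x + r *\<^sub>R y" by transfer (simp add: scaleR_add_right)
  show "(r + s) *\<^sub>R x = r *\<^sub>R x + s *\<^sub>R x" by transfer (simp add: scaleR_add_left)
  show "r *\<^sub>R s *\<^sub>R x = (r * s) *\<^sub>R x" by transfer simp
  show "1 *\<^sub>R x = x" by transfer simp
qed

end

instantiation ell2 :: (type) real_inner
begin

(* The real part of the Hermitian inner product; it induces the same norm. *)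
lift_definition inner_ell2 :: "'a ell2 \<Rightarrow> 'a ell2 \<Rightarrow> real" is "\<lambda>f g. \<Sum>\<^sub>\<infinity>v. f v \<bullet> g v" .

lift_definition norm_ell2 :: "'a ell2 \<Rightarrow> real" is "\<lambda>f. sqrt (\<Sum>\<^sub>\<infinity>v. (cmod (f v))\<^sup>2)" .

definition dist_ell2 :: "'a ell2 \<Rightarrow> 'a ell2 \<Rightarrow> real" where
  "dist_ell2 x y = norm (x - y)"

definition sgn_ell2 :: "'a ell2 \<Rightarrow> 'a ell2" where
  "sgn_ell2 x = x /\<^sub>R norm x"

definition uniformity_ell2 :: "('a ell2 \<times> 'a ell2) filter" where
  "uniformity_ell2 = (INF e\<in>{0<..}. principal {(x, y). dist x y < e})"

definition open_ell2 :: "'a ell2 set \<Rightarrow> bool" where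
  "open_ell2 U = (\<forall>x\<in>U. \<forall>\<^sub>F (x', y) in uniformity. x' = x \<longrightarrow> y \<in> U)"

instance
proof
  fix x y z :: "'a ell2" and r s :: real
  show "dist x y = norm (x - y)" by (simp add: dist_ell2_def)
  show "sgn x = x /\<^sub>R norm x" by (simp add: sgn_ell2_def)
  show "uniformity = (INF e\<in>{0<..}. principal {(x, y :: 'a ell2). dist x y < e})"
    by (simp add: uniformity_ell2_def)
  show "open U = (\<forall>x\<in>U. \<forall>\<^sub>F (x', y) in uniformity. x' = x \<longrightarrow> y \<in> U)" for U :: "'a ell2 set"
    by (simp add: open_ell2_def)
  show "x \<bullet> y = y \<bullet> x" by transfer (simp add: inner_commute)
  show "(x + y) \<bullet> z = x \<bullet> z + y \<bullet> z"
    by transfer (simp add: inner_add_left infsum_add summable_on_inner)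
  show "(r *\<^sub>R x) \<bullet> y = r * (x \<bullet> y)"
    by transfer (simp add: infsum_cmult_right summable_on_inner)
  show "0 \<le> x \<bullet> x" by transfer (simp add: infsum_nonneg)
  show "(x \<bullet> x = 0) = (x = 0)"
  proof
    assume "x \<bullet> x = 0"
    then show "x = 0"
    proof transfer
      fix f :: "'a \<Rightarrow> complex"
      assume f: "(\<lambda>v. (cmod (f v))\<^sup>2) summable_on UNIV" and "(\<Sum>\<^sub>\<infinity>v. f v \<bullet> f v) = 0"
      then have "f v \<bullet> f v = 0" for v
        by (intro nonneg_infsum_le_0D[of "\<lambda>v. f v \<bullet> f v" UNIV]) (auto intro: summable_on_inner)
      then show "f = (\<lambda>_. 0)" by auto
    qed
  qed (transfer, simp)
  show "norm x = sqrt (x \<bullet> x)" by transfer (simp add: power2_norm_eq_inner)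
qed

end

lift_definition scaleC :: "complex \<Rightarrow> 'a ell2 \<Rightarrow> 'a ell2" (infixr \<open>*\<^sub>C\<close> 75)
  is "\<lambda>c f v. c * f v"
  by (simp add: norm_mult power_mult_distrib summable_on_cmult_right)

global_interpretation complex_ell2: vector_space "scaleC :: complex \<Rightarrow> 'a ell2 \<Rightarrow> 'a ell2"
  by unfold_locales (transfer; simp add: algebra_simps)+

lift_definition ket :: "'a \<Rightarrow> 'a ell2" is "\<lambda>u v. if v = u then 1 else 0"
proof -
  fix u :: 'a
  show "(\<lambda>v. (cmod (if v = u then 1 else 0))\<^sup>2) summable_on UNIV"
    by (rule summable_on_cong_neutral[THEN iffD1, OF _ _ _ summable_on_finite[of "{u}"]]) auto
qed

definition bounded_operator :: "('a ell2 \<Rightarrow> 'a ell2) \<Rightarrow> bool" where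
  "bounded_operator T \<longleftrightarrow> Vector_Spaces.linear (*\<^sub>C) (*\<^sub>C) T \<and> bounded_linear T"

definition contraction :: "('a ell2 \<Rightarrow> 'a ell2) \<Rightarrow> bool" where
  "contraction T \<longleftrightarrow> bounded_operator T \<and> onorm T \<le> 1"

definition class_C1 :: "('a ell2 \<Rightarrow> 'a ell2) \<Rightarrow> bool" where
  "class_C1 T \<longleftrightarrow> contraction T \<and> (\<forall>h. (\<lambda>n. norm ((T ^^ n) h)) \<longlonglongrightarrow> 0 \<longrightarrow> h = 0)"

definition cyclic_vector :: "('a ell2 \<Rightarrow> 'a ell2) \<Rightarrow> 'a ell2 \<Rightarrow> bool" where
  "cyclic_vector T h \<longleftrightarrow> closure (complex_ell2.span (range (\<lambda>n. (T ^^ n) h))) = UNIV"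

(* Trunk k is the integer vertex k. The primed vertices 1', 2', ... are indexed from zero:
   Branch n is (n + 1)'. *)
datatype vertex = Trunk int | Branch nat

definition E0 :: "(vertex \<times> vertex) set" where
  "E0 = {(Trunk k, Trunk (k + 1)) | k. True} \<union> {(Trunk 0, Branch 0)}
      \<union> {(Branch n, Branch (Suc n)) | n. True}"

definition Chi :: "vertex \<Rightarrow> vertex set" where
  "Chi u = {v. (u, v) \<in> E0}"

(* A bounded operator is determined by its values on the basis vectors, so for bounded weights
   there is exactly one such S; see weighted_shift_exists and weighted_shift_unique below. *)
definition weighted_shift :: "(vertex \<Rightarrow> real) \<Rightarrow> (vertex ell2 \<Rightarrow> vertex ell2) \<Rightarrow> bool" where
  "weighted_shift lam S \<longleftrightarrow> bounded_operator S \<and>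
     (\<forall>u. S (ket u) = (\<Sum>v\<in>Chi u. complex_of_real (lam v) *\<^sub>C ket v))"

lemma coord_simps [simp]:
  "coord (0 :: 'a ell2) v = 0"
  "coord (x + y) v = coord x v + coord y v"
  "coord (- x) v = - coord x v"
  "coord (x - y) v = coord x v - coord y v"
  "coord (r *\<^sub>R x) v = r *\<^sub>R coord x v"
  "coord (c *\<^sub>C x) v = c * coord x v"
  "coord (ket u) v = (if v = u then 1 else 0)"
  unfolding minus_ell2_def
  by (simp_all only: zero_ell2.rep_eq plus_ell2.rep_eq uminus_ell2.rep_eq scaleR_ell2.rep_eq
      scaleC.rep_eq ket.rep_eq diff_conv_add_uminus)

lemma coord_sum [simp]: "coord (\<Sum>i\<in>A. x i) v = (\<Sum>i\<in>A. coord (x i) v)"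
  by (induction A rule: infinite_finite_induct) simp_all

lemma ell2_eqI: "(\<And>v. coord x v = coord y v) \<Longrightarrow> x = y"
  by (simp add: coord_inject[symmetric] fun_eq_iff)

lemma summable_coord: "(\<lambda>v. (cmod (coord x v))\<^sup>2) summable_on A"
proof -
  have "(\<lambda>v. (cmod (coord x v))\<^sup>2) summable_on UNIV"
    using coord[of x] by simp
  then show ?thesis
    by (rule summable_on_subset_banach) simp
qed

lemma norm_ell2_power2: "(norm x)\<^sup>2 = (\<Sum>\<^sub>\<infinity>v. (cmod (coord x v))\<^sup>2)"
  by (simp add: norm_ell2.rep_eq infsum_nonneg)

lemma Chi_simps:
  "Chi (Trunk k) = (if k = 0 then {Trunk 1, Branch 0} else {Trunk (k + 1)})"
  "Chi (Branch n) = {Branch (Suc n)}"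
  by (auto simp: Chi_def E0_def)

fun parent :: "vertex \<Rightarrow> vertex" where
  "parent (Trunk k) = Trunk (k - 1)"
| "parent (Branch 0) = Trunk 0"
| "parent (Branch (Suc n)) = Branch n"

lemma mem_Chi_iff: "v \<in> Chi u \<longleftrightarrow> u = parent v"
  by (cases u; cases v rule: parent.cases) (auto simp: Chi_simps)

lemma weighted_shift_exists:
  assumes "bounded (range lam)"
  shows "\<exists>S. weighted_shift lam S"
proof -
  obtain M where M: "\<And>v. \<bar>lam v\<bar> \<le> M"
    using assms by (auto simp: bounded_iff)
  define s where "s f v = complex_of_real (lam v) * f (parent v)" for f :: "vertex \<Rightarrow> complex" and v
  have inj: "inj_on parent (range Trunk)" "inj_on parent (range Branch)"
  proof -
    show "inj_on parent (range Trunk)" by (auto simp: inj_on_def)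
    show "inj_on parent (range Branch)"
    proof (rule inj_onI)
      fix u v assume "u \<in> range Branch" "v \<in> range Branch" "parent u = parent v"
      then show "u = v" by (cases u rule: parent.cases; cases v rule: parent.cases) auto
    qed
  qed
  have part: "(\<lambda>v. (cmod (coord x (parent v)))\<^sup>2) summable_on A \<and>
      (\<Sum>\<^sub>\<infinity>v\<in>A. (cmod (coord x (parent v)))\<^sup>2) \<le> (norm x)\<^sup>2"
    if "inj_on parent A" for x A
  proof
    show "(\<lambda>v. (cmod (coord x (parent v)))\<^sup>2) summable_on A"
      using summable_on_reindex[OF that, of "\<lambda>v. (cmod (coord x v))\<^sup>2"] summable_coord[of x]
      by (simp add: o_def)
    have "(\<Sum>\<^sub>\<infinity>v\<in>A. (cmod (coord x (parent v)))\<^sup>2) = (\<Sum>\<^sub>\<infinity>v\<in>parent ` A. (cmod (coord x v))\<^sup>2)"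
      using infsum_reindex[OF that, of "\<lambda>v. (cmod (coord x v))\<^sup>2"] by (simp add: o_def)
    also have "\<dots> \<le> (norm x)\<^sup>2"
      unfolding norm_ell2_power2
      by (rule infsum_mono_neutral) (auto intro: summable_coord)
    finally show "(\<Sum>\<^sub>\<infinity>v\<in>A. (cmod (coord x (parent v)))\<^sup>2) \<le> (norm x)\<^sup>2" .
  qed
  have U: "UNIV = range Trunk \<union> range Branch"
    using vertex.exhaust by blast
  have sum_parent: "(\<lambda>v. (cmod (coord x (parent v)))\<^sup>2) summable_on UNIV" for x
    unfolding U using part[OF inj(1)] part[OF inj(2)] by (intro summable_on_Un_disjoint) auto
  have parent_le: "(\<Sum>\<^sub>\<infinity>v. (cmod (coord x (parent v)))\<^sup>2) \<le> 2 * (norm x)\<^sup>2" for x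
    unfolding U using part[OF inj(1), of x] part[OF inj(2), of x]
    by (subst infsum_Un_disjoint) auto
  have s_le: "(cmod (s f v))\<^sup>2 \<le> M\<^sup>2 * (cmod (f (parent v)))\<^sup>2" for f v
    unfolding s_def norm_mult power_mult_distrib norm_of_real
    using M[of v] by (intro mult_right_mono power_mono) auto
  have s_summable: "(\<lambda>v. (cmod (s (coord x) v))\<^sup>2) summable_on UNIV" for x
    by (rule summable_on_comparison_test[OF summable_on_cmult_right[OF sum_parent[of x], of "M\<^sup>2"]])
      (use s_le in auto)
  define S where "S x = Abs_ell2 (s (coord x))" for x
  have S: "coord (S x) v = complex_of_real (lam v) * coord x (parent v)" for x v
    using s_summable by (simp add: S_def Abs_ell2_inverse s_def)
  have lin: "Vector_Spaces.linear (*\<^sub>C) (*\<^sub>C) S"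
    by unfold_locales (auto intro!: ell2_eqI simp: S algebra_simps)
  have bound: "norm (S x) \<le> norm x * (sqrt 2 * \<bar>M\<bar>)" for x
  proof (rule power2_le_imp_le)
    have "(norm (S x))\<^sup>2 \<le> (\<Sum>\<^sub>\<infinity>v. M\<^sup>2 * (cmod (coord x (parent v)))\<^sup>2)"
      unfolding norm_ell2_power2
    proof (rule infsum_mono)
      show "(cmod (coord (S x) v))\<^sup>2 \<le> M\<^sup>2 * (cmod (coord x (parent v)))\<^sup>2" for v
        using s_le[of "coord x" v] by (simp only: S s_def)
    qed (intro summable_coord summable_on_cmult_right sum_parent)+
    also have "\<dots> = M\<^sup>2 * (\<Sum>\<^sub>\<infinity>v. (cmod (coord x (parent v)))\<^sup>2)"
      by (simp add: infsum_cmult_right sum_parent)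
    also have "\<dots> \<le> M\<^sup>2 * (2 * (norm x)\<^sup>2)"
      by (intro mult_left_mono parent_le) simp
    finally show "(norm (S x))\<^sup>2 \<le> (norm x * (sqrt 2 * \<bar>M\<bar>))\<^sup>2"
      by (simp add: power_mult_distrib mult_ac)
  qed simp
  have "bounded_linear S"
    by (rule bounded_linear_intro[OF _ _ bound]) (auto intro!: ell2_eqI simp: S algebra_simps)
  moreover have "S (ket u) = (\<Sum>v\<in>Chi u. complex_of_real (lam v) *\<^sub>C ket v)" for u
  proof (rule ell2_eqI)
    fix w
    have fin: "finite (Chi u)" by (cases u) (auto simp: Chi_simps)
    have "coord (\<Sum>v\<in>Chi u. complex_of_real (lam v) *\<^sub>C ket v) w =
        (\<Sum>v\<in>Chi u. if w = v then complex_of_real (lam v) else 0)"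
      by (auto intro!: sum.cong)
    then show "coord (S (ket u)) w = coord (\<Sum>v\<in>Chi u. complex_of_real (lam v) *\<^sub>C ket v) w"
      using fin by (auto simp: S sum.delta' mem_Chi_iff)
  qed
  ultimately show ?thesis
    using lin by (auto simp: weighted_shift_def bounded_operator_def)
qed

lemma weighted_shift_unique:
  assumes "weighted_shift lam S" "weighted_shift lam T"
  shows "S = T"
proof
  fix x :: "vertex ell2"
  define D where "D y = S y - T y" for y
  define p where "p F = (\<Sum>v\<in>F. coord x v *\<^sub>C ket v)" for F :: "vertex set"
  have lin: "module_hom (*\<^sub>C) (*\<^sub>C) S" "module_hom (*\<^sub>C) (*\<^sub>C) T"
    using assms by (auto simp: weighted_shift_def bounded_operator_def Vector_Spaces.linear_def)
  have D: "bounded_linear D"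
    unfolding D_def using assms
    by (intro bounded_linear_sub) (auto simp: weighted_shift_def bounded_operator_def)
  have ket: "S (ket u) = T (ket u)" for u
    using assms by (simp add: weighted_shift_def)
  have Dp: "D (p F) = 0" for F
    unfolding D_def p_def module_hom.sum[OF lin(1)] module_hom.sum[OF lin(2)]
      module_hom.scale[OF lin(1)] module_hom.scale[OF lin(2)] ket by simp
  have "(p \<longlongrightarrow> x) (finite_subsets_at_top UNIV)"
  proof -
    let ?n = "\<lambda>v. (cmod (coord x v))\<^sup>2"
    have lim: "((\<lambda>F. \<Sum>v\<in>F. ?n v) \<longlongrightarrow> (norm x)\<^sup>2) (finite_subsets_at_top UNIV)"
      using has_sum_infsum[OF summable_coord[of x UNIV]]
      by (simp add: has_sum_def norm_ell2_power2)
    have eq: "norm (x - p F) = sqrt ((norm x)\<^sup>2 - (\<Sum>v\<in>F. ?n v))" if F: "finite F" for F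
    proof -
      have c: "coord (p F) v = (if v \<in> F then coord x v else 0)" for v
      proof -
        have "coord (p F) v = (\<Sum>u\<in>F. if v = u then coord x u else 0)"
          unfolding p_def by (auto intro!: sum.cong)
        then show ?thesis using F by simp
      qed
      have "(norm (x - p F))\<^sup>2 = (\<Sum>\<^sub>\<infinity>v\<in>UNIV - F. ?n v)"
        unfolding norm_ell2_power2 by (rule infsum_cong_neutral) (auto simp: c)
      also have "\<dots> = (norm x)\<^sup>2 - (\<Sum>v\<in>F. ?n v)"
        using F by (subst infsum_Diff) (auto simp: norm_ell2_power2 summable_coord)
      finally show ?thesis by (metis norm_ge_zero real_sqrt_unique)
    qed
    have "((\<lambda>F. sqrt ((norm x)\<^sup>2 - (\<Sum>v\<in>F. ?n v))) \<longlongrightarrow> sqrt ((norm x)\<^sup>2 - (norm x)\<^sup>2))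
        (finite_subsets_at_top UNIV)"
      by (intro tendsto_intros lim)
    then have "((\<lambda>F. norm (x - p F)) \<longlongrightarrow> sqrt ((norm x)\<^sup>2 - (norm x)\<^sup>2)) (finite_subsets_at_top UNIV)"
      by (rule Lim_transform_eventually)
        (rule eventually_finite_subsets_at_top_weakI, simp add: eq)
    then show ?thesis
      by (subst tendsto_dist_iff) (simp add: dist_norm norm_minus_commute)
  qed
  then have "((\<lambda>F. D (p F)) \<longlongrightarrow> D x) (finite_subsets_at_top UNIV)"
    by (rule bounded_linear.tendsto[OF D])
  then have "((\<lambda>F :: vertex set. 0) \<longlongrightarrow> D x) (finite_subsets_at_top UNIV)"
    by (simp only: Dp)
  then have "D x = 0"
    by (simp add: tendsto_const_iff)
  then show "S x = T x" by (simp add: D_def)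
qed

end

theory Submission
  imports Defs
begin

text \<open>Along each of the two bi-infinite paths of the tree (the trunk, and the path that leaves it
  at the vertex 0) the weights have strictly positive infinite tail products \<open>c k\<close>, because \<open>S\<close> is a
  contraction of class \<open>C\<^sub>1\<close>. Put \<open>f\<^sub>x k = c k * x (\<pi> k)\<close> for the first path \<open>\<pi>\<close>, and \<open>g\<^sub>x\<close> likewise for
  the second one. Then \<open>S\<close> acts on both sequences as the plain bilateral shift on square-summable
  sequences. For a fixed vector \<open>h\<close> and any integer \<open>m\<close>, commutativity of the convolution shows that
  the bounded functional \<open>x \<mapsto> \<Sum>\<^sub>k g\<^sub>x k * f\<^sub>h (m - k) - f\<^sub>x k * g\<^sub>h (m - k)\<close> annihilates the orbit of
  \<open>h\<close>. If \<open>h\<close> is cyclic, all these functionals vanish; evaluating them at basis vectors beyond the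
  branching vertex yields \<open>f\<^sub>h = g\<^sub>h = 0\<close>, so \<open>h = 0\<close>, which is absurd.\<close>

section \<open>Coordinates, reindexing and basis expansion\<close>

lemma norm_ket [simp]: "norm (ket u) = 1"
proof -
  have "(norm (ket u))\<^sup>2 = (\<Sum>\<^sub>\<infinity>v\<in>{u}. (1::real))"
    unfolding norm_ell2_power2 by (rule infsum_cong_neutral) auto
  then show ?thesis by (simp add: power2_eq_1_iff) (smt (verit) norm_ge_zero)
qed

lemma norm_coord_le: "cmod (coord x v) \<le> norm x"
proof (rule power2_le_imp_le)
  have "(\<Sum>\<^sub>\<infinity>w\<in>{v}. (cmod (coord x w))\<^sup>2) \<le> (norm x)\<^sup>2"
    unfolding norm_ell2_power2 by (rule infsum_mono_neutral) (auto intro: summable_coord)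
  then show "(cmod (coord x v))\<^sup>2 \<le> (norm x)\<^sup>2" by simp
qed simp

lemma bounded_linear_coord: "bounded_linear (\<lambda>x. coord x v)"
  by (rule bounded_linear_intro[where K = 1]) (auto intro: norm_coord_le)

lemma norm_scaleC [simp]: "norm (c *\<^sub>C x) = cmod c * norm x"
proof -
  have "(norm (c *\<^sub>C x))\<^sup>2 = (cmod c * norm x)\<^sup>2"
    unfolding norm_ell2_power2 power_mult_distrib
    by (simp add: norm_mult power_mult_distrib infsum_cmult_right summable_coord)
  then show ?thesis
    by (simp add: power2_eq_iff_nonneg)
qed

lemma inner_ell2_eq: "x \<bullet> y = (\<Sum>\<^sub>\<infinity>v. coord x v \<bullet> coord y v)"
  by (rule inner_ell2.rep_eq)

text \<open>An injection selects coordinates of \<open>x\<close> without repetition, and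
  \<open>\<tau>\<close> only shrinks them. A general \<open>\<tau>\<close> covers both uses:
  weighting along a line and complex conjugation, which is not complex linear.\<close>

lemma ell2_reindex:
  fixes x :: "'a ell2" and \<tau> :: "'b \<Rightarrow> complex \<Rightarrow> complex"
  assumes "inj \<pi>" and \<tau>: "\<And>k z. cmod (\<tau> k z) \<le> cmod z"
  shows "\<exists>y. (\<forall>k. coord y k = \<tau> k (coord x (\<pi> k))) \<and> norm y \<le> norm x"
proof -
  let ?n = "\<lambda>v. (cmod (coord x v))\<^sup>2"
  have sum: "(\<lambda>k. ?n (\<pi> k)) summable_on UNIV"
    using summable_on_reindex[OF \<open>inj \<pi>\<close>, of ?n] summable_coord[of x] by (simp add: o_def)
  have le: "(cmod (\<tau> k (coord x (\<pi> k))))\<^sup>2 \<le> ?n (\<pi> k)" for k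
    using \<tau> by (intro power_mono) auto
  have "(\<lambda>k. (cmod (\<tau> k (coord x (\<pi> k))))\<^sup>2) summable_on UNIV"
    by (rule summable_on_comparison_test[OF sum]) (use le in auto)
  then have y: "coord (Abs_ell2 (\<lambda>k. \<tau> k (coord x (\<pi> k)))) k = \<tau> k (coord x (\<pi> k))" for k
    by (simp add: Abs_ell2_inverse)
  have "norm (Abs_ell2 (\<lambda>k. \<tau> k (coord x (\<pi> k)))) \<le> norm x"
  proof (rule power2_le_imp_le)
    have "(norm (Abs_ell2 (\<lambda>k. \<tau> k (coord x (\<pi> k)))))\<^sup>2 \<le> (\<Sum>\<^sub>\<infinity>k. ?n (\<pi> k))"
      unfolding norm_ell2_power2
    proof (rule infsum_mono)
      show "(cmod (coord (Abs_ell2 (\<lambda>k. \<tau> k (coord x (\<pi> k)))) k))\<^sup>2 \<le> ?n (\<pi> k)" for k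
        unfolding y by (rule le)
    qed (intro summable_coord sum)+
    also have "\<dots> = (\<Sum>\<^sub>\<infinity>v\<in>range \<pi>. ?n v)"
      using infsum_reindex[OF \<open>inj \<pi>\<close>, of ?n] by (simp add: o_def)
    also have "\<dots> \<le> (norm x)\<^sup>2"
      unfolding norm_ell2_power2 by (rule infsum_mono_neutral) (auto intro: summable_coord)
    finally show "(norm (Abs_ell2 (\<lambda>k. \<tau> k (coord x (\<pi> k)))))\<^sup>2 \<le> (norm x)\<^sup>2" .
  qed simp
  with y show ?thesis by blast
qed

text \<open>The squared distance from a finite partial sum to \<open>x\<close> is the tail of the
  convergent series of squared moduli.\<close>

lemma ket_expansion: "((\<lambda>v. coord x v *\<^sub>C ket v) has_sum x) UNIV"
proof -
  define p where "p F = (\<Sum>v\<in>F. coord x v *\<^sub>C ket v)" for F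
  let ?n = "\<lambda>v. (cmod (coord x v))\<^sup>2"
  have eq: "(norm x)\<^sup>2 - sum ?n F = (dist (p F) x)\<^sup>2" if F: "finite F" for F
  proof -
    have "coord (p F) v = (\<Sum>u\<in>F. if v = u then coord x u else 0)" for v
      unfolding p_def by (auto intro!: sum.cong)
    then have c: "coord (p F) v = (if v \<in> F then coord x v else 0)" for v
      using F by simp
    have "(dist (p F) x)\<^sup>2 = (\<Sum>\<^sub>\<infinity>v\<in>UNIV - F. ?n v)"
      unfolding dist_norm norm_ell2_power2 by (rule infsum_cong_neutral) (auto simp: c)
    also have "\<dots> = (norm x)\<^sup>2 - sum ?n F"
      using F by (subst infsum_Diff) (auto simp: norm_ell2_power2 summable_coord)
    finally show ?thesis ..
  qed
  have "((\<lambda>F. (norm x)\<^sup>2 - sum ?n F) \<longlongrightarrow> (norm x)\<^sup>2 - (norm x)\<^sup>2) (finite_subsets_at_top UNIV)"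
    using has_sum_infsum[OF summable_coord[of x UNIV]]
    by (intro tendsto_intros) (simp add: has_sum_def norm_ell2_power2)
  then have "((\<lambda>F. (dist (p F) x)\<^sup>2) \<longlongrightarrow> (norm x)\<^sup>2 - (norm x)\<^sup>2) (finite_subsets_at_top UNIV)"
    by (rule Lim_transform_eventually)
      (rule eventually_finite_subsets_at_top_weakI, rule eq)
  from tendsto_real_sqrt[OF this] have "((\<lambda>F. dist (p F) x) \<longlongrightarrow> 0) (finite_subsets_at_top UNIV)"
    by simp
  then show ?thesis
    unfolding has_sum_def p_def by (rule tendsto_dist_iff[THEN iffD2])
qed

text \<open>In the basis expansion of \<open>x\<close>, only the term at the unique parent of
  \<open>v\<close> contributes to coordinate \<open>v\<close> of the image.\<close>

lemma coord_weighted_shift: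
  assumes "weighted_shift lam S"
  shows "coord (S x) v = complex_of_real (lam v) * coord x (parent v)"
proof -
  have S: "bounded_linear S" "module_hom (*\<^sub>C) (*\<^sub>C) S"
    using assms by (auto simp: weighted_shift_def bounded_operator_def Vector_Spaces.linear_def)
  have ket: "coord (S (ket u)) v = (if u = parent v then complex_of_real (lam v) else 0)" for u
  proof -
    have "finite (Chi u)" by (cases u) (auto simp: Chi_simps)
    moreover have "coord (S (ket u)) v =
        (\<Sum>w\<in>Chi u. if v = w then complex_of_real (lam w) else 0)"
      using assms by (auto simp: weighted_shift_def intro!: sum.cong)
    ultimately show ?thesis by (simp add: mem_Chi_iff)
  qed
  have "((\<lambda>u. coord (S (coord x u *\<^sub>C ket u)) v) has_sum coord (S x) v) UNIV"
    using has_sum_bounded_linear[OF bounded_linear_compose[OF bounded_linear_coord S(1)]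
        ket_expansion] by (simp add: o_def)
  then have "((\<lambda>u. coord x u * coord (S (ket u)) v) has_sum coord (S x) v) UNIV"
    by (simp add: module_hom.scale[OF S(2)])
  moreover have "((\<lambda>u. coord x u * coord (S (ket u)) v) has_sum
      (\<Sum>u\<in>{parent v}. coord x u * coord (S (ket u)) v)) UNIV"
    by (rule has_sum_finite_neutralI[of "{parent v}"]) (auto simp: ket)
  ultimately show ?thesis
    by (auto simp: ket mult.commute dest: has_sum_unique)
qed

section \<open>The two lines and their tail products\<close>

text \<open>A line is a bi-infinite path that has passed the branching vertex before index 1.\<close>

definition line :: "(int \<Rightarrow> vertex) \<Rightarrow> bool" where
  "line \<pi> \<longleftrightarrow> inj \<pi> \<and> (\<forall>k. parent (\<pi> (k + 1)) = \<pi> k) \<and> (\<forall>k\<ge>1. Chi (\<pi> k) = {\<pi> (k + 1)})"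

text \<open>Since \<open>Branch\<close> counts from zero, the offset puts 1' at position 1: both
  lines have the branching vertex at position 0 and are disjoint from position 1 on.\<close>

definition side :: "int \<Rightarrow> vertex" where
  "side k = (if k \<le> 0 then Trunk k else Branch (nat (k - 1)))"

lemma line_Trunk: "line Trunk"
  by (auto simp: line_def inj_on_def Chi_simps)

lemma parent_Branch: "parent (Branch n) = (if n = 0 then Trunk 0 else Branch (n - 1))"
  by (cases n) auto

lemma line_side: "line side"
  unfolding line_def
proof (intro conjI allI impI)
  show "inj side" by (rule injI) (auto simp: side_def split: if_splits)
  fix k
  show "parent (side (k + 1)) = side k"
    by (auto simp: side_def parent_Branch nat_diff_distrib)
  show "Chi (side k) = {side (k + 1)}" if "1 \<le> k"
    using that by (auto simp: side_def Chi_simps)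
qed

text \<open>\<open>c k\<close> is the infinite product of the weights at positions after
  \<open>k\<close>. Contractivity bounds each weight by 1, so the partial products decrease to a
  limit.\<close>

lemma tail_product:
  assumes pos: "\<And>v. 0 < lam v" and S: "weighted_shift lam S" and "class_C1 S" and "line \<pi>"
  obtains c :: "int \<Rightarrow> real" where "\<And>k. 0 < c k" "\<And>k. c k \<le> 1"
    "\<And>k. c k = lam (\<pi> (k + 1)) * c (k + 1)"
proof -
  have lin: "bounded_linear S" "onorm S \<le> 1" and
    C1: "\<And>h. (\<lambda>n. norm ((S ^^ n) h)) \<longlonglongrightarrow> 0 \<Longrightarrow> h = 0"
    using \<open>class_C1 S\<close> by (auto simp: class_C1_def contraction_def bounded_operator_def)
  have hom: "module_hom (*\<^sub>C) (*\<^sub>C) S"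
    using S by (auto simp: weighted_shift_def bounded_operator_def Vector_Spaces.linear_def)
  have le1: "lam v \<le> 1" for v
  proof -
    have "\<bar>lam v\<bar> = cmod (coord (S (ket (parent v))) v)"
      by (simp add: coord_weighted_shift[OF S])
    also have "\<dots> \<le> norm (S (ket (parent v)))" by (rule norm_coord_le)
    also have "\<dots> \<le> onorm S * norm (ket (parent v))" by (rule onorm[OF lin(1)])
    finally show ?thesis using lin(2) by simp
  qed
  define P where "P k n = (\<Prod>i<n. lam (\<pi> (k + 1 + int i)))" for k n
  define c where "c k = lim (P k)" for k
  have P_bounds: "0 < P k n" "P k n \<le> 1" for k n
    unfolding P_def using pos le1 by (auto intro: prod_pos prod_le_1 less_imp_le)
  have "decseq (P k)" for k
    unfolding P_def using pos le1
    by (intro decseq_SucI) (auto intro: mult_left_le prod_nonneg less_imp_le)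
  then have "convergent (P k)" for k
    using decseq_convergent[of "P k" 0] P_bounds(1) by (metis convergentI less_imp_le)
  then have lim: "P k \<longlonglongrightarrow> c k" for k
    by (simp add: c_def convergent_LIMSEQ_iff)
  have P_Suc: "P k (Suc n) = lam (\<pi> (k + 1)) * P (k + 1) n" for k n
    unfolding P_def by (subst prod.lessThan_Suc_shift) (simp add: algebra_simps)
  have c_step: "c k = lam (\<pi> (k + 1)) * c (k + 1)" for k
    using LIMSEQ_unique[OF LIMSEQ_Suc[OF lim[of k]]] tendsto_mult_left[OF lim[of "k + 1"]]
    by (simp add: P_Suc)
  \<comment> \<open>From position 1 on no vertex branches, so the orbit of a basis vector stays on
    the line and its norms are the partial products. A zero limit would then contradict class
    \<open>C1\<close>.\<close>
  have iter: "(S ^^ n) (ket (\<pi> k)) = complex_of_real (P k n) *\<^sub>C ket (\<pi> (k + int n))"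
    if "1 \<le> k" for k n
  proof (induction n)
    case (Suc n)
    have "S (ket (\<pi> (k + int n))) =
        complex_of_real (lam (\<pi> (k + 1 + int n))) *\<^sub>C ket (\<pi> (k + int (Suc n)))"
      using S \<open>line \<pi>\<close> that by (simp add: weighted_shift_def line_def algebra_simps)
    then show ?case
      by (simp add: Suc.IH module_hom.scale[OF hom] P_def)
  qed (simp add: P_def)
  have pos1: "0 < c k" if "1 \<le> k" for k
  proof -
    have "0 \<le> c k"
      using lim P_bounds by (meson LIMSEQ_le_const less_imp_le)
    moreover have "c k \<noteq> 0"
    proof
      assume "c k = 0"
      moreover have "norm ((S ^^ n) (ket (\<pi> k))) = P k n" for n
        unfolding iter[OF that] using P_bounds(1)[of k n] by simp
      ultimately have "ket (\<pi> k) = 0"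
        using lim[of k] by (intro C1) simp
      then show False
        using norm_ket[of "\<pi> k"] by (simp del: norm_ket)
    qed
    ultimately show ?thesis by simp
  qed
  \<comment> \<open>The recursion carries positivity backwards from position 1, past the branching
    vertex.\<close>
  have neg: "0 < c (1 - int n)" for n
  proof (induction n)
    case (Suc n)
    then show ?case
      using c_step[of "1 - int (Suc n)"] pos by simp
  qed (simp add: pos1)
  have "0 < c k" for k
    using pos1[of k] neg[of "nat (1 - k)"] by (cases "1 \<le> k") auto
  moreover have "c k \<le> 1" for k
    using lim P_bounds by (meson LIMSEQ_le_const2)
  ultimately show ?thesis using that c_step by blast
qed

text \<open>The recursion for \<open>c\<close> absorbs the weights, turning \<open>S\<close> into
  the unweighted shift; \<open>c k \<le> 1\<close> makes \<open>F\<close> bounded.\<close>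

lemma line_transform:
  assumes pos: "\<And>v. 0 < lam v" and S: "weighted_shift lam S" and "class_C1 S" and "line \<pi>"
  obtains F :: "vertex ell2 \<Rightarrow> int ell2" and c :: "int \<Rightarrow> real"
  where "bounded_linear F" "\<And>k. 0 < c k"
    "\<And>x k. coord (F x) k = complex_of_real (c k) * coord x (\<pi> k)"
    "\<And>n x k. coord (F ((S ^^ n) x)) k = coord (F x) (k - int n)"
proof -
  obtain c where c: "\<And>k. 0 < c k" "\<And>k. c k \<le> 1" "\<And>k. c k = lam (\<pi> (k + 1)) * c (k + 1)"
    using tail_product[OF assms] by blast
  have "\<exists>y. (\<forall>k. coord y k = complex_of_real (c k) * coord x (\<pi> k)) \<and> norm y \<le> norm x" for x
  proof (rule ell2_reindex)
    show "inj \<pi>" using \<open>line \<pi>\<close> by (simp add: line_def)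
    show "cmod (complex_of_real (c k) * z) \<le> cmod z" for k z
      using c(1)[of k] mult_right_mono[OF c(2)[of k] norm_ge_zero[of z]] by (simp add: norm_mult)
  qed
  then obtain F where F: "\<And>x k. coord (F x) k = complex_of_real (c k) * coord x (\<pi> k)"
    "\<And>x. norm (F x) \<le> norm x"
    by metis
  have "bounded_linear F"
    by (rule bounded_linear_intro[where K = 1]) (auto intro!: ell2_eqI simp: F algebra_simps)
  moreover have "coord (F ((S ^^ n) x)) k = coord (F x) (k - int n)" for n x k
  proof (induction n arbitrary: k)
    case (Suc n)
    have "parent (\<pi> k) = \<pi> (k - 1)"
      using \<open>line \<pi>\<close> unfolding line_def by (metis diff_add_cancel)
    then have "coord (F (S y)) k = coord (F y) (k - 1)" for y
      using c(3)[of "k - 1"] by (simp add: F coord_weighted_shift[OF S])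
    then show ?case by (simp add: Suc.IH algebra_simps)
  qed simp
  ultimately show ?thesis using that c(1) F(1) by blast
qed

section \<open>Functionals that annihilate an orbit\<close>

text \<open>The conjugates in \<open>p\<close> and \<open>q\<close> cancel the one in the inner
  product, so both sides are the real part of \<open>z\<close> times the convolution of
  \<open>a\<close> and \<open>b\<close> at \<open>m - n\<close>; the substitution
  \<open>k \<mapsto> n + m - k\<close> exchanges the factors.\<close>

lemma convolution_commute:
  fixes a b p q :: "int ell2"
  assumes "\<And>k. coord p k = cnj (coord b (m - k))" "\<And>k. coord q k = cnj (coord a (m - k))"
    and "\<And>k. coord a' k = z * coord a (k - n)" "\<And>k. coord b' k = z * coord b (k - n)"
  shows "a' \<bullet> p = b' \<bullet> q"
  unfolding inner_ell2_eq
  by (rule infsum_reindex_bij_witness[of _ "\<lambda>k. n + m - k" "\<lambda>k. n + m - k"])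
    (auto simp: assms inner_complex_def algebra_simps)

lemma inner_ell2_singleton:
  assumes "\<And>j. j \<noteq> k \<Longrightarrow> coord x j = 0"
  shows "x \<bullet> y = coord x k \<bullet> coord y k"
proof -
  have "x \<bullet> y = (\<Sum>\<^sub>\<infinity>j\<in>{k}. coord x j \<bullet> coord y j)"
    unfolding inner_ell2_eq by (rule infsum_cong_neutral) (auto simp: assms)
  then show ?thesis by simp
qed

text \<open>Here \<open>\<psi>\<close> is only real linear, so vanishing is required on all complex
  multiples of the orbit; continuity passes from the span to its closure.\<close>

lemma functional_eq_0_if_cyclic:
  assumes "cyclic_vector T h" and "bounded_linear \<psi>"
    and orbit: "\<And>z n. \<psi> (z *\<^sub>C (T ^^ n) h) = (0 :: real)"
  shows "\<psi> x = 0"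
proof -
  interpret bounded_linear \<psi> by fact
  have "\<psi> y = 0" if "y \<in> complex_ell2.span (range (\<lambda>n. (T ^^ n) h))" for y
    using that by (induction rule: complex_ell2.span_induct_alt) (auto simp: add orbit)
  then have "closure (complex_ell2.span (range (\<lambda>n. (T ^^ n) h))) \<subseteq> {y. \<psi> y = 0}"
    by (intro closure_minimal closed_Collect_eq continuous_on continuous_on_const
        continuous_on_id) auto
  then show ?thesis
    using assms(1) by (auto simp: cyclic_vector_def)
qed

theorem theorem6p6:
  fixes lam :: "vertex \<Rightarrow> real" and S :: "vertex ell2 \<Rightarrow> vertex ell2"
  assumes "\<And>v. 0 < lam v"
    and "bounded (range lam)"
    and "weighted_shift lam S"
    and "contraction S"
    and "class_C1 S"
  shows "\<not> (\<exists>h. cyclic_vector S h)"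
proof
  assume "\<exists>h. cyclic_vector S h"
  then obtain h where h: "cyclic_vector S h" ..
  obtain F c where F: "bounded_linear F" "\<And>k. 0 < c k"
    "\<And>x k. coord (F x) k = complex_of_real (c k) * coord x (Trunk k)"
    "\<And>n x k. coord (F ((S ^^ n) x)) k = coord (F x) (k - int n)"
    using line_transform[OF assms(1,3,5) line_Trunk] by blast
  obtain G d where G: "bounded_linear G" "\<And>k. 0 < d k"
    "\<And>x k. coord (G x) k = complex_of_real (d k) * coord x (side k)"
    "\<And>n x k. coord (G ((S ^^ n) x)) k = coord (G x) (k - int n)"
    using line_transform[OF assms(1,3,5) line_side] by blast
  have FG0: "coord (F h) i = 0 \<and> coord (G h) i = 0" for i
  proof -
    \<comment> \<open>With this choice, \<open>p\<close> and \<open>q\<close> at position 1, the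
      first one past the branching, are the conjugates of the coordinates at
      \<open>i\<close>.\<close>
    define m where "m = i + 1"
    have "inj (\<lambda>k. m - k)" by (rule injI) simp
    then have "\<exists>p. (\<forall>k. coord p k = cnj (coord y (m - k))) \<and> norm p \<le> norm y" for y
      by (intro ell2_reindex) auto
    then obtain p q where p: "\<And>k. coord p k = cnj (coord (G h) (m - k))"
      and q: "\<And>k. coord q k = cnj (coord (F h) (m - k))"
      by meson
    \<comment> \<open>This is the real part of the annihilating functional.\<close>
    define \<psi> where "\<psi> x = G x \<bullet> q - F x \<bullet> p" for x
    have "bounded_linear \<psi>"
      unfolding \<psi>_def
      by (intro bounded_linear_sub bounded_linear_compose[OF bounded_linear_inner_left] F(1) G(1))
    moreover have "\<psi> (z *\<^sub>C (S ^^ n) h) = 0" for z n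
    proof -
      have "F (z *\<^sub>C (S ^^ n) h) \<bullet> p = G (z *\<^sub>C (S ^^ n) h) \<bullet> q"
        by (rule convolution_commute[OF p q, where z = z and n = "int n"])
          (simp_all add: F(3) G(3) F(4)[unfolded F(3)] G(4)[unfolded G(3)])
      then show ?thesis by (simp add: \<psi>_def)
    qed
    ultimately have 0: "\<psi> x = 0" for x
      by (rule functional_eq_0_if_cyclic[OF h])
    \<comment> \<open>\<open>Trunk 1\<close> is off the side line, so \<open>G\<close> kills this
      vector; the scalar \<open>coord p 1\<close> turns the remaining inner product into a squared
      modulus.\<close>
    have "\<psi> (coord p 1 *\<^sub>C ket (Trunk 1)) = - (c 1 * (cmod (coord p 1))\<^sup>2)"
    proof -
      have "G (coord p 1 *\<^sub>C ket (Trunk 1)) = 0"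
        by (rule ell2_eqI) (auto simp: G(3) side_def)
      moreover have "F (coord p 1 *\<^sub>C ket (Trunk 1)) \<bullet> p =
          coord (F (coord p 1 *\<^sub>C ket (Trunk 1))) 1 \<bullet> coord p 1"
        by (rule inner_ell2_singleton) (simp add: F(3))
      ultimately show ?thesis
        by (simp add: \<psi>_def F(3) power2_norm_eq_inner flip: scaleR_conv_of_real)
    qed
    moreover have "\<psi> (coord q 1 *\<^sub>C ket (side 1)) = d 1 * (cmod (coord q 1))\<^sup>2"
    proof -
      have "F (coord q 1 *\<^sub>C ket (side 1)) = 0"
        by (rule ell2_eqI) (auto simp: F(3) side_def)
      moreover have "G (coord q 1 *\<^sub>C ket (side 1)) \<bullet> q =
          coord (G (coord q 1 *\<^sub>C ket (side 1))) 1 \<bullet> coord q 1"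
        by (rule inner_ell2_singleton) (auto simp: G(3) side_def)
      ultimately show ?thesis
        by (simp add: \<psi>_def G(3) power2_norm_eq_inner flip: scaleR_conv_of_real)
    qed
    \<comment> \<open>Both values are 0 while \<open>c 1\<close> and \<open>d 1\<close> are
      positive, so \<open>coord p 1\<close> and \<open>coord q 1\<close> vanish.\<close>
    ultimately show ?thesis
      using F(2)[of 1] G(2)[of 1] by (simp add: 0 p q m_def)
  qed
  have "coord h v = 0" for v
  proof (cases v)
    case (Trunk k)
    then show ?thesis using FG0[of k] F(2)[of k] by (simp add: F(3))
  next
    case (Branch n)
    then show ?thesis using FG0[of "int n + 1"] G(2)[of "int n + 1"] by (simp add: G(3) side_def)
  qed
  then have "h = 0" by (intro ell2_eqI) simp
  \<comment> \<open>The orbit of 0 is 0, so pairing with a unit basis vector is a nonzero functional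
    that annihilates it.\<close>
  have "h \<noteq> 0"
  proof
    assume "h = 0"
    have "(S ^^ n) 0 = 0" for n
      using assms(3) by (induction n)
        (auto simp: weighted_shift_def bounded_operator_def linear_simps)
    then have "ket (Trunk 0) \<bullet> ket (Trunk 0) = 0"
      using functional_eq_0_if_cyclic[OF h bounded_linear_inner_left] \<open>h = 0\<close> by simp
    then show False by (simp flip: power2_norm_eq_inner)
  qed
  with \<open>h = 0\<close> show False by contradiction
qed

end
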